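(* There are only finitely many positive integers $n$ such that both $n$ and $d(n)$ are highly composite.
   Context: For a positive integer $n$, $d(n)=\sum_{d\mid n}1$ denotes the number of positive divisors of $n$. A positive integer $n$ is called highly composite if $d(m)<d(n)$ for every positive integer $m<n$. *)

theory Defs
  imports Main
begin

(* Only meant for n > 0: the set of divisors of 0 is infinite, so divisor_count 0 = 0. *)
definition divisor_count :: "nat \<Rightarrow> nat" where
  "divisor_count n = (\<Sum>k | k dvd n. 1)"

definition highly_composite :: "nat \<Rightarrow> bool" where
  "highly_composite n \<longleftrightarrow>
     n > 0 \<and> (\<forall>m. 0 < m \<and> m < n \<longrightarrow> divisor_count m < divisor_count n)"

end

theory Submission
  imports Defs "HOL-Computational_Algebra.Primes" "HOL-Real_Asymp.Real_Asymp"
begin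

text \<open>
  Let \<open>q\<close> be the least prime not dividing a highly composite \<open>n\<close>; then the primes dividing \<open>n\<close> are
  exactly those below \<open>q\<close>, say \<open>k\<close> many. If \<open>2\<^sup>j > q\<close>, trading \<open>p\<^sup>j\<close> for \<open>q\<close> shows that all exponents in
  \<open>n\<close> are below \<open>2j = O(log q)\<close>. Trading three primes for two shows that only primes up to about
  \<open>q\<^bsup>2/3\<^esup>\<close> can have exponent at least 2. By a Chebyshev bound almost all of the \<open>k\<close> exponents are
  therefore 1, so \<open>d(n)\<close> is divisible by a huge power of 2. But the primes dividing \<open>d(n)\<close> are
  \<open>O(log q)\<close>, and the first trade, applied to \<open>d(n)\<close> with a prime from Euclid's theorem, bounds its
  2-adic valuation by \<open>O((log q)\<^sup>2)\<close>. So \<open>q\<close> is bounded, and hence \<open>n\<close>.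
\<close>

section \<open>The divisor function\<close>

lemma divisor_count_eq_card: "divisor_count n = card {k. k dvd n}"
  by (simp add: divisor_count_def)

lemma divisor_count_pos: "n > 0 \<Longrightarrow> divisor_count n > 0"
  unfolding divisor_count_eq_card by (subst card_gt_0_iff) auto

text \<open>Each divisor of \<open>p ^ a * b\<close> is \<open>p ^ i * k\<close> for exactly one
  pair with \<open>i <= a\<close> and \<open>k dvd b\<close>: its multiplicity at \<open>p\<close>
  recovers \<open>i\<close>.\<close>

lemma divisor_count_prime_power_mult:
  assumes p: "prime p" and b: "\<not> p dvd b" "b > 0"
  shows "divisor_count (p ^ a * b) = (a + 1) * divisor_count b"
proof -
  have p0: "p > 0" using p by (simp add: prime_gt_0_nat)
  have mult: "multiplicity p (p ^ i * k) = i" if "k dvd b" for i k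
    using that b p by (intro multiplicity_decomposeI[OF refl]) (auto dest: dvd_trans)
  have "bij_betw (\<lambda>(i, k). p ^ i * k) ({..a} \<times> {k. k dvd b}) {k. k dvd p ^ a * b}"
    unfolding bij_betw_def
  proof
    show "inj_on (\<lambda>(i, k). p ^ i * k) ({..a} \<times> {k. k dvd b})"
    proof (rule inj_onI, clarify)
      fix i k i' k' assume *: "k dvd b" "k' dvd b" "p ^ i * k = p ^ i' * k'"
      then have "i = i'" using mult by metis
      then show "i = i' \<and> k = k'" using * p0 by simp
    qed
    show "(\<lambda>(i, k). p ^ i * k) ` ({..a} \<times> {k. k dvd b}) = {k. k dvd p ^ a * b}"
    proof (intro equalityI subsetI)
      fix x assume "x \<in> {k. k dvd p ^ a * b}"
      then obtain y z where x: "x = y * z" "y dvd p ^ a" "z dvd b"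
        using division_decomp[of x "p ^ a" b] by auto
      then obtain i where "i \<le> a" "y = p ^ i"
        using p divides_primepow_nat by blast
      with x show "x \<in> (\<lambda>(i, k). p ^ i * k) ` ({..a} \<times> {k. k dvd b})"
        by (auto intro!: image_eqI[where x = "(i, z)"])
    qed (auto intro: mult_dvd_mono le_imp_power_dvd)
  qed
  from bij_betw_same_card[OF this] show ?thesis
    by (simp add: divisor_count_eq_card card_cartesian_product)
qed

lemma divisor_count_mult_prime:
  assumes "prime p" "\<not> p dvd b" "b > 0"
  shows "divisor_count (p * b) = 2 * divisor_count b"
  using divisor_count_prime_power_mult[OF assms, of 1] by simp

lemma prime_power_decomp_nat:
  fixes n p :: nat
  assumes "prime p" "n > 0"
  obtains b where "n = p ^ multiplicity p n * b" "\<not> p dvd b" "b > 0"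
proof -
  obtain b where b: "n = p ^ multiplicity p n * b" "\<not> p dvd b"
    using multiplicity_decompose'[of n p] assms by (metis not_prime_unit neq0_conv)
  with assms show ?thesis using that[of b] by (cases "b = 0") auto
qed

text \<open>Lowering an exponent a by one scales the divisor count by a / (a + 1); the form is
  cross-multiplied to stay within the naturals.\<close>

lemma divisor_count_div_prime:
  assumes p: "prime p" and n: "n > 0" and d: "p dvd n"
  shows "(multiplicity p n + 1) * divisor_count (n div p) = multiplicity p n * divisor_count n"
proof -
  obtain b where b: "n = p ^ multiplicity p n * b" "\<not> p dvd b" "b > 0"
    using prime_power_decomp_nat[OF p n] .
  define a where "a = multiplicity p n"
  have a0: "a > 0" using p n d unfolding a_def
    by (simp add: prime_multiplicity_gt_zero_iff)
  then obtain c where c: "a = Suc c" by (cases a) auto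
  have n': "n = p ^ a * b" using b(1) by (simp add: a_def)
  have "n div p = p ^ c * b" using p unfolding n' c by (simp add: prime_gt_0_nat)
  then show ?thesis
    using divisor_count_prime_power_mult[OF p b(2,3), of c]
      divisor_count_prime_power_mult[OF p b(2,3), of a]
    unfolding a_def[symmetric] by (subst (2) n') (simp add: c algebra_simps)
qed

text \<open>Every prime of exponent exactly 1 contributes a factor 2 to the divisor count.\<close>

lemma two_power_dvd_divisor_count:
  assumes "finite S" "n > 0" "\<And>p. p \<in> S \<Longrightarrow> prime p \<and> multiplicity p n = 1"
  shows "2 ^ card S dvd divisor_count n"
  using assms
proof (induction S arbitrary: n rule: finite_induct)
  case (insert p S)
  have p: "prime p" "multiplicity p n = 1" using insert.prems by auto
  obtain b where b: "n = p * b" "\<not> p dvd b" "b > 0"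
    using prime_power_decomp_nat[OF p(1) insert.prems(1)] p(2) by auto
  have "multiplicity r b = 1" if "r \<in> S" for r
  proof -
    have r: "prime r" "multiplicity r n = 1" "r \<noteq> p" using that insert by auto
    have "\<not> r dvd p" using r p primes_dvd_imp_eq by blast
    then have "multiplicity r (p * b) = multiplicity r b"
      using r by (intro multiplicity_prime_elem_times_other) auto
    then show ?thesis using r b by simp
  qed
  then have "2 ^ card S dvd divisor_count b"
    using insert.prems b(3) by (intro insert.IH) auto
  then show ?case
    using insert.hyps divisor_count_mult_prime[OF p(1) b(2,3)] b(1) by simp
qed simp

text \<open>The divisor count is a product of numbers a + 1, each at most \<open>B\<close>, and a
  prime dividing it divides one of them. The induction strips one full prime power at a
  time.\<close>

lemma prime_dvd_divisor_count_le:
  fixes r n B :: nat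
  assumes "n > 0" "\<And>p. prime p \<Longrightarrow> multiplicity p n < B" "prime r" "r dvd divisor_count n"
  shows "r \<le> B"
  using assms
proof (induction n rule: less_induct)
  case (less n)
  show ?case
  proof (cases "n = 1")
    case True
    then show ?thesis using less.prems by (simp add: divisor_count_eq_card)
  next
    case False
    then obtain p where p: "prime p" "p dvd n" using prime_factor_nat by blast
    define a where "a = multiplicity p n"
    obtain b where b: "n = p ^ a * b" "\<not> p dvd b" "b > 0"
      using prime_power_decomp_nat[OF p(1) less.prems(1)] unfolding a_def by blast
    have "r dvd (a + 1) * divisor_count b"
      using divisor_count_prime_power_mult[OF p(1) b(2,3), of a] less.prems(4)
      unfolding b(1)[symmetric] by simp
    then consider "r dvd a + 1" | "r dvd divisor_count b"
      using less.prems(3) prime_dvd_mult_iff by blast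
    then show ?thesis
    proof cases
      case 1
      then have "r \<le> a + 1" by (rule dvd_imp_le) simp
      then show ?thesis using less.prems(2)[OF p(1)] by (simp add: a_def)
    next
      case 2
      have dvd: "b dvd n" using b by simp
      have "b \<noteq> n" using b(2) p(2) by blast
      then have "b < n" using dvd less.prems(1) by (simp add: dvd_imp_le le_neq_implies_less)
      moreover have "multiplicity q b < B" if "prime q" for q
        using dvd_imp_multiplicity_le[OF dvd, of q] less.prems(1) less.prems(2)[OF that] by simp
      ultimately show ?thesis using less.IH 2 b(3) less.prems(3) by blast
    qed
  qed
qed

section \<open>Exchange arguments for highly composite numbers\<close>

lemma highly_composite_pos: "highly_composite n \<Longrightarrow> n > 0"
  by (simp add: highly_composite_def)

lemma highly_compositeD:
  "highly_composite n \<Longrightarrow> 0 < m \<Longrightarrow> m < n \<Longrightarrow> divisor_count m < divisor_count n"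
  by (simp add: highly_composite_def)

text \<open>Replacing \<open>p ^ j\<close> by \<open>q\<close> lowers \<open>n\<close> and scales
  the divisor count by 2(a - j + 1) / (a + 1), which exceeds 1 as soon as a is at least 2j.\<close>

lemma highly_composite_multiplicity_less:
  fixes n p q j :: nat
  assumes hc: "highly_composite n" and p: "prime p" and q: "prime q" "\<not> q dvd n" "q < p ^ j"
  shows "multiplicity p n < 2 * j"
proof (rule ccontr)
  assume *: "\<not> multiplicity p n < 2 * j"
  define a where "a = multiplicity p n"
  have n: "n > 0" using hc by (rule highly_composite_pos)
  obtain b where b: "n = p ^ a * b" "\<not> p dvd b" "b > 0"
    using prime_power_decomp_nat[OF p n] unfolding a_def by blast
  have j: "2 * j \<le> a" using * by (simp add: a_def)
  \<comment> \<open>No prime is below \<open>p ^ 0 = 1\<close>. A positive \<open>j\<close> makes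
    \<open>p\<close> divide \<open>n\<close>, hence differ from \<open>q\<close>.\<close>
  have j0: "j > 0" using q prime_gt_0_nat[of q] by (cases j) auto
  have "p dvd n" using b(1) j j0 by auto
  then have pq: "p \<noteq> q" using q by auto
  define m where "m = p ^ (a - j) * (q * b)"
  have qb: "\<not> p dvd q * b" "\<not> q dvd b"
    using b q p pq by (auto simp: prime_dvd_mult_iff primes_dvd_imp_eq)
  have m0: "m > 0" using p q b by (simp add: m_def prime_gt_0_nat)
  have "m < n"
  proof -
    have "m < p ^ (a - j) * (p ^ j * b)"
      unfolding m_def using q(3) p b(3) by (simp add: prime_gt_0_nat)
    also have "\<dots> = n" using j unfolding b(1) by (simp flip: power_add mult.assoc)
    finally show ?thesis .
  qed
  then have "divisor_count m < divisor_count n" by (rule highly_compositeD[OF hc m0])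
  moreover have "divisor_count m = (a - j + 1) * (2 * divisor_count b)"
    using divisor_count_prime_power_mult[OF p qb(1), of "a - j"] b(3) q
      divisor_count_mult_prime[OF q(1) qb(2) b(3)]
    by (simp add: m_def prime_gt_0_nat)
  moreover have "divisor_count n = (a + 1) * divisor_count b"
    using divisor_count_prime_power_mult[OF p b(2,3), of a] unfolding b(1)[symmetric] .
  ultimately have "(2 * (a - j + 1)) * divisor_count b < (a + 1) * divisor_count b"
    by (simp only: ac_simps)
  then have "2 * (a - j + 1) < a + 1" unfolding mult_less_cancel2 by blast
  with j show False by simp
qed

text \<open>By the previous trade with \<open>j = 1\<close>, a prime factor \<open>p\<close> above
  \<open>q\<close> has exponent 1; swapping it for \<open>q\<close> then lowers \<open>n\<close> but
  keeps the divisor count.\<close>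

lemma highly_composite_prime_dvd_less:
  fixes n p q :: nat
  assumes hc: "highly_composite n" and p: "prime p" "p dvd n" and q: "prime q" "\<not> q dvd n"
  shows "p < q"
proof (rule ccontr)
  assume "\<not> p < q"
  moreover have "p \<noteq> q" using p q by auto
  ultimately have "q < p ^ 1" by simp
  from highly_composite_multiplicity_less[OF hc p(1) q this]
  have mult: "multiplicity p n = 1"
    using p highly_composite_pos[OF hc] prime_multiplicity_gt_zero_iff[of p n] by simp
  obtain b where b: "n = p * b" "\<not> p dvd b" "b > 0"
    using prime_power_decomp_nat[OF p(1) highly_composite_pos[OF hc]] mult by auto
  have "\<not> q dvd b" using b q by auto
  then have "divisor_count (q * b) = divisor_count n"
    using divisor_count_mult_prime q p b by simp
  moreover have "q * b < n" using b \<open>q < p ^ 1\<close> by simp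
  ultimately show False
    using highly_compositeD[OF hc, of "q * b"] q b by (simp add: prime_gt_0_nat)
qed

text \<open>The ratio a / (a + 1) is at least 2/3 once a is at least 2.\<close>

lemma divisor_count_div_prime_ge:
  assumes p: "prime p" and n: "n > 0" and a: "multiplicity p n \<ge> 2"
  shows "2 * divisor_count n \<le> 3 * divisor_count (n div p)"
proof -
  define a where "a = multiplicity p n"
  have "p dvd n" using a not_dvd_imp_multiplicity_0[of p n] by force
  from divisor_count_div_prime[OF p n this]
  have eq: "(a + 1) * divisor_count (n div p) = a * divisor_count n" by (simp add: a_def)
  have "(a + 1) * (2 * divisor_count n) \<le> (3 * a) * divisor_count n"
    using a by (simp add: a_def)
  also have "\<dots> = (a + 1) * (3 * divisor_count (n div p))" using eq by simp
  finally show ?thesis using nat_mult_le_cancel1[of "a + 1"] by simp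
qed

lemma multiplicity_div_other_prime:
  fixes p q n :: nat
  assumes "prime p" "prime q" "p \<noteq> q" "q dvd n"
  shows "multiplicity p (n div q) = multiplicity p n"
proof -
  have "\<not> p dvd q" using assms primes_dvd_imp_eq by blast
  then have "multiplicity p (q * (n div q)) = multiplicity p (n div q)"
    using assms by (intro multiplicity_prime_elem_times_other) auto
  then show ?thesis using assms by simp
qed

text \<open>Trading three primes of exponent at least 2 for two new primes multiplies the number of
  divisors by at least \<open>(2/3)\<^sup>3 \<sqdot> 2\<^sup>2 = 32/27 > 1\<close>.\<close>

lemma highly_composite_three_primes:
  fixes n p1 p2 p3 q q' :: nat
  assumes hc: "highly_composite n"
    and p: "prime p1" "prime p2" "prime p3" "p1 \<noteq> p2" "p1 \<noteq> p3" "p2 \<noteq> p3"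
    and mult: "multiplicity p1 n \<ge> 2" "multiplicity p2 n \<ge> 2" "multiplicity p3 n \<ge> 2"
    and q: "prime q" "prime q'" "q \<noteq> q'" "\<not> q dvd n" "\<not> q' dvd n"
  shows "p1 * p2 * p3 \<le> q * q'"
proof (rule ccontr)
  assume *: "\<not> p1 * p2 * p3 \<le> q * q'"
  have n: "n > 0" using hc by (rule highly_composite_pos)
  define n1 where "n1 = n div p1"
  define n2 where "n2 = n1 div p2"
  define n3 where "n3 = n2 div p3"
  have d1: "p1 dvd n" using mult not_dvd_imp_multiplicity_0[of p1 n] by force
  \<comment> \<open>As the three primes are distinct, dividing by one leaves the exponents of the
    others at least 2.\<close>
  have m1: "multiplicity p2 n1 \<ge> 2" "multiplicity p3 n1 \<ge> 2"
    using mult p d1 by (simp_all add: n1_def multiplicity_div_other_prime)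
  have d2: "p2 dvd n1" using m1 not_dvd_imp_multiplicity_0[of p2 n1] by force
  have m2: "multiplicity p3 n2 \<ge> 2"
    using m1 p d2 by (simp add: n2_def multiplicity_div_other_prime)
  have d3: "p3 dvd n2" using m2 not_dvd_imp_multiplicity_0[of p3 n2] by force
  have e: "n = p1 * n1" "n1 = p2 * n2" "n2 = p3 * n3"
    using d1 d2 d3 by (simp_all add: n1_def n2_def n3_def)
  have pos: "n1 > 0" "n2 > 0" "n3 > 0" using n e by auto
  have "2 * divisor_count n \<le> 3 * divisor_count n1"
    "2 * divisor_count n1 \<le> 3 * divisor_count n2"
    "2 * divisor_count n2 \<le> 3 * divisor_count n3"
    using divisor_count_div_prime_ge p n pos mult m1 m2 by (simp_all add: n1_def n2_def n3_def)
  then have le: "8 * divisor_count n \<le> 27 * divisor_count n3" by linarith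
  have "n3 dvd n" using e by simp
  then have nd: "\<not> q dvd n3" "\<not> q' dvd n3" using q dvd_trans by blast+
  then have nd': "\<not> q dvd q' * n3" using q primes_dvd_imp_eq[of q q'] by (auto simp: prime_dvd_mult_iff)
  define m where "m = q * (q' * n3)"
  have "divisor_count m = 4 * divisor_count n3"
    using divisor_count_mult_prime[OF q(1) nd'] divisor_count_mult_prime[OF q(2) nd(2) pos(3)] pos q
    by (simp add: m_def prime_gt_0_nat)
  moreover have "m < n"
  proof -
    have "m = (q * q') * n3" by (simp add: m_def)
    also have "\<dots> < (p1 * p2 * p3) * n3" using * pos by simp
    also have "\<dots> = n" using e by simp
    finally show ?thesis .
  qed
  then have "divisor_count m < divisor_count n"
    using highly_compositeD[OF hc, of m] pos q by (simp add: m_def prime_gt_0_nat)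
  moreover have "divisor_count n > 0" using divisor_count_pos n .
  ultimately show False using le by linarith
qed

section \<open>A lower bound for the number of primes\<close>

text \<open>Leibniz's harmonic triangle
  \<open>1 / (m C(n,m)) = 1 / (m C(n-1,m)) - 1 / ((m+1) C(n,m+1))\<close>
  shows that \<open>D / (m C(n,m))\<close> is an integer for every common multiple \<open>D\<close> of \<open>1,\<dots>,n\<close>.\<close>

lemma mult_binomial_dvd:
  fixes D n m :: nat
  assumes "\<And>k. 1 \<le> k \<Longrightarrow> k \<le> n \<Longrightarrow> k dvd D" "1 \<le> m" "m \<le> n"
  shows "m * (n choose m) dvd D"
  using assms
proof (induction n arbitrary: m)
  case (Suc n)
  note IH = Suc.IH and prems = Suc.prems
  have top: "Suc n dvd D" using prems by auto
  show ?case using prems(3,2)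
  \<comment> \<open>Descend from the end of the row: the entry at \<open>m\<close> comes from the
    one at \<open>m\<close> in the row above (outer induction) and the one at \<open>Suc m\<close>
    in the same row (inner induction).\<close>
  proof (induction m rule: inc_induct)
    case base
    then show ?case using top by simp
  next
    case (step m)
    have m: "1 \<le> m" "m \<le> n" using step by auto
    define x where "x = m * (n choose m)"
    define y where "y = Suc m * (Suc n choose Suc m)"
    define z where "z = m * (Suc n choose m)"
    have "x dvd D" unfolding x_def using IH[OF _ m] prems(1) by simp
    moreover have "y dvd D" unfolding y_def using step by simp
    ultimately obtain u v where uv: "D = x * u" "D = y * v" unfolding dvd_def by blast
    have pos: "x > 0" "y > 0" "z > 0" using m by (auto simp: x_def y_def z_def)
    have y_eq: "y = Suc n * (n choose m)" unfolding y_def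
      using Suc_times_binomial_eq[of n m] by (simp only: mult.commute)
    have z_eq: "(Suc n - m) * z = m * y"
      using binomial_absorb_comp[of "Suc n" m] m by (simp add: z_def y_eq algebra_simps)
    have x_eq: "Suc n * x = m * y" unfolding x_def y_eq by (simp only: ac_simps)
    \<comment> \<open>The triangle identity 1/z = 1/x - 1/y, scaled by \<open>D\<close>. It passes
      through the reals because subtraction of naturals truncates.\<close>
    have "real D = real z * (real u - real v)"
    proof -
      have r: "real (Suc n) * real x = real m * real y"
        "(real (Suc n) - real m) * real z = real m * real y"
        using arg_cong[OF x_eq, of real] arg_cong[OF z_eq, of real] m
        by (simp_all only: of_nat_mult of_nat_diff le_SucI)
      have u: "real u = real D / real x" and v: "real v = real D / real y"
        using uv pos by (simp_all add: field_simps flip: of_nat_mult)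
      have "1 / real x = real (Suc n) / (real m * real y)"
        unfolding r(1)[symmetric] by simp
      moreover have "1 / real y = real m / (real m * real y)"
        using pos m by simp
      moreover have "1 / real z = (real (Suc n) - real m) / (real m * real y)"
        unfolding r(2)[symmetric] using m by simp
      ultimately have "1 / real z = 1 / real x - 1 / real y"
        by (simp only: diff_divide_distrib)
      then have "real D * (1 / real z) = real D * (1 / real x - 1 / real y)" by (simp only:)
      then have "real D / real z = real u - real v"
        unfolding u v by (simp add: right_diff_distrib)
      then show ?thesis using pos by (simp add: divide_eq_eq mult.commute)
    qed
    then have "real_of_int (int D) = real_of_int (int z * (int u - int v))" by simp
    then have "int D = int z * (int u - int v)" by (simp only: of_int_eq_iff)
    then have "int z dvd int D" by simp
    then show ?case unfolding z_def[symmetric] by simp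
  qed
qed simp

section \<open>Chebyshev's lower bound for the prime counting function\<close>

definition prime_count :: "nat \<Rightarrow> nat" where
  "prime_count N = card {p. prime p \<and> p \<le> N}"

lemma finite_primes_le: "finite {p::nat. prime p \<and> p \<le> N}"
  by (rule finite_subset[of _ "{..N}"]) auto

lemma prime_count_0 [simp]: "prime_count 0 = 0"
proof -
  have "{p::nat. prime p \<and> p \<le> 0} = {}" by auto
  then show ?thesis unfolding prime_count_def by simp
qed

lemma prime_count_mono: "M \<le> N \<Longrightarrow> prime_count M \<le> prime_count N"
  unfolding prime_count_def by (rule card_mono[OF finite_primes_le]) auto

text \<open>The witness is the least common multiple of 1, ..., N: it has one prime power for each
  prime up to \<open>N\<close>, and each such power divides some \<open>k <= N\<close>.\<close>

lemma common_multiple_le_power_prime_count: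
  fixes N :: nat
  obtains D where "D > 0" "\<And>k. 1 \<le> k \<Longrightarrow> k \<le> N \<Longrightarrow> k dvd D" "D \<le> N ^ prime_count N"
proof (cases "N = 0")
  case True
  \<comment> \<open>\<open>N = 0\<close> is split off because \<open>Max\<close> would range over an
    empty set; the bound is then \<open>0 ^ 0 = 1\<close>.\<close>
  then show ?thesis using that[of 1] by simp
next
  case False
  define P where "P = {p::nat. prime p \<and> p \<le> N}"
  define e where "e p = Max ((\<lambda>k. multiplicity p k) ` {1..N})" for p
  define D where "D = (\<Prod>p\<in>P. p ^ e p)"
  have fin: "finite P" unfolding P_def by (rule finite_primes_le)
  have "D > 0" unfolding D_def P_def by (auto intro!: prod_pos simp: prime_gt_0_nat)
  moreover have "k dvd D" if k: "1 \<le> k" "k \<le> N" for k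
  proof (rule multiplicity_le_imp_dvd)
    fix p :: nat assume p: "prime p"
    show "multiplicity p k \<le> multiplicity p D"
    proof (cases "p \<in> P")
      case True
      have "p ^ e p dvd D" unfolding D_def using fin True by (rule dvd_prodI)
      then have "e p \<le> multiplicity p D"
        using p \<open>D > 0\<close> by (intro multiplicity_geI) auto
      moreover have "multiplicity p k \<le> e p" unfolding e_def using k by (intro Max_ge) auto
      ultimately show ?thesis by simp
    next
      case False
      then have "p > N" using p by (simp add: P_def)
      then have "\<not> p dvd k" using k by (auto dest: dvd_imp_le)
      then show ?thesis by (simp add: not_dvd_imp_multiplicity_0)
    qed
  qed (use k in auto)
  moreover have "D \<le> N ^ prime_count N"
  proof -
    have "p ^ e p \<le> N" for p
    proof -
      have "e p \<in> (\<lambda>k. multiplicity p k) ` {1..N}"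
        unfolding e_def using False by (intro Max_in) auto
      then obtain k where k: "1 \<le> k" "k \<le> N" "e p = multiplicity p k" by auto
      have "p ^ e p \<le> k" unfolding k(3) using k(1) by (intro dvd_imp_le multiplicity_dvd) auto
      then show ?thesis using k by simp
    qed
    then have "D \<le> (\<Prod>p\<in>P. N)" unfolding D_def by (intro prod_mono) auto
    then show ?thesis by (simp add: P_def prime_count_def)
  qed
  ultimately show ?thesis by (rule that)
qed

text \<open>The common multiple is divisible by n C(2n,n), which is at least 4^n / 2. Of the lost
  exponent 2, one unit pays for this halving and one for rounding \<open>N\<close> down to
  2n.\<close>

lemma two_power_le_power_prime_count:
  fixes N :: nat
  assumes "N \<ge> 2"
  shows "2 ^ (N - 2) \<le> N ^ prime_count N"
proof -
  define n where "n = N div 2"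
  have n: "n > 0" "2 * n \<le> N" "N \<le> 2 * n + 1" using assms by (auto simp: n_def)
  obtain D where D: "D > 0" "\<And>k. 1 \<le> k \<Longrightarrow> k \<le> N \<Longrightarrow> k dvd D" "D \<le> N ^ prime_count N"
    using common_multiple_le_power_prime_count by blast
  have "n * ((2 * n) choose n) dvd D" by (rule mult_binomial_dvd) (use D n in auto)
  then have le: "n * ((2 * n) choose n) \<le> D" using D(1) by (rule dvd_imp_le)
  have "4 ^ n / 2 \<le> real n * real ((2 * n) choose n)"
    using central_binomial_lower_bound[OF n(1)] n(1) by (simp add: field_simps)
  then have "(4::real) ^ n \<le> real (2 * (n * ((2 * n) choose n)))" by simp
  then have "real (4 ^ n) \<le> real (2 * (n * ((2 * n) choose n)))" by simp
  then have "4 ^ n \<le> 2 * (n * ((2 * n) choose n))" by (simp only: of_nat_le_iff)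
  moreover have "(2::nat) * 2 ^ (N - 2) \<le> 2 ^ (2 * n)"
    using n assms by (simp flip: power_Suc)
  ultimately have "2 * 2 ^ (N - 2) \<le> 2 * (n * ((2 * n) choose n))" by (simp add: power_mult)
  then show ?thesis using le D(3) by simp
qed

lemma prime_count_ge:
  assumes "N \<ge> 2"
  shows "(real N - 2) * ln 2 \<le> real (prime_count N) * ln (real N)"
proof -
  have "real (2 ^ (N - 2)) \<le> real (N ^ prime_count N)"
    using two_power_le_power_prime_count[OF assms] by (simp only: of_nat_le_iff)
  then have "ln (2 ^ (N - 2)) \<le> ln (real N ^ prime_count N)"
    using assms by simp
  then show ?thesis using assms by (simp add: ln_realpow)
qed

section \<open>Finiteness\<close>

text \<open>Reduces finiteness to bounding one missing prime: it bounds the prime factors, their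
  number and their exponents.\<close>

lemma highly_composite_le:
  fixes n q :: nat
  assumes hc: "highly_composite n" and q: "prime q" "\<not> q dvd n" "q \<le> Q"
  shows "n \<le> (Q ^ (2 * Q)) ^ Q"
proof -
  have n: "n > 0" using hc by (rule highly_composite_pos)
  have Q0: "Q > 0" using q prime_gt_0_nat[of q] by simp
  have less: "p < q" if "p \<in> prime_factors n" for p
    using highly_composite_prime_dvd_less[OF hc _ _ q(1,2), of p] that by (simp add: in_prime_factors_iff)
  have "n = (\<Prod>p\<in>prime_factors n. p ^ multiplicity p n)"
    using n by (simp add: prime_factorization_nat)
  also have "\<dots> \<le> (\<Prod>p\<in>prime_factors n. Q ^ (2 * Q))"
  proof (intro prod_mono conjI)
    fix p assume p: "p \<in> prime_factors n"
    then have pr: "prime p" by (simp add: in_prime_factors_iff)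
    \<comment> \<open>The crude choice \<open>j = q\<close> in the exponent bound suffices
      here.\<close>
    have "q < 2 ^ q" by simp
    also have "\<dots> \<le> p ^ q" using pr by (intro power_mono) (auto simp: prime_ge_2_nat)
    finally have "multiplicity p n < 2 * q"
      using highly_composite_multiplicity_less[OF hc pr q(1,2)] by blast
    then have "p ^ multiplicity p n \<le> Q ^ multiplicity p n" "multiplicity p n \<le> 2 * Q"
      using less[OF p] q by (auto intro!: power_mono)
    then show "p ^ multiplicity p n \<le> Q ^ (2 * Q)"
      using Q0 power_increasing[of "multiplicity p n" "2 * Q" Q] by linarith
  qed simp
  also have "\<dots> = (Q ^ (2 * Q)) ^ card (prime_factors n)" by simp
  also have "\<dots> \<le> (Q ^ (2 * Q)) ^ Q"
  proof (rule power_increasing)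
    have "prime_factors n \<subseteq> {..<Q}" using less q(3) by (meson lessThan_iff less_le_trans subsetI)
    then have "card (prime_factors n) \<le> card {..<Q}" by (rule card_mono[OF finite_lessThan])
    then show "card (prime_factors n) \<le> Q" by simp
    show "1 \<le> Q ^ (2 * Q)" using Q0 by (intro one_le_power) simp
  qed
  finally show ?thesis .
qed

section \<open>Counting repeated primes and bounding the power of 2\<close>

lemma card_le_two_if_no_three:
  assumes "finite A" "\<And>x y z. x \<in> A \<Longrightarrow> y \<in> A \<Longrightarrow> z \<in> A \<Longrightarrow> x \<noteq> y \<Longrightarrow> x \<noteq> z \<Longrightarrow> y \<noteq> z \<Longrightarrow> False"
  shows "card A \<le> 2"
proof (rule ccontr)
  assume "\<not> card A \<le> 2"
  then obtain B where "B \<subseteq> A" "card B = 3"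
    using obtain_subset_with_card_n[of 3 A] by auto
  then show False using assms(2) unfolding card_3_iff by blast
qed

text \<open>Three repeated primes above \<open>t ^ 2\<close> would have product above
  \<open>t ^ 6 >= q * q'\<close>, contradicting the three-for-two trade. So at most two lie above
  \<open>t ^ 2\<close>.\<close>

lemma card_repeated_primes_le:
  fixes n q q' t :: nat
  assumes hc: "highly_composite n" and q: "prime q" "prime q'" "q \<noteq> q'" "\<not> q dvd n" "\<not> q' dvd n"
    and t: "q \<le> t ^ 3" "q' \<le> t ^ 3"
  shows "card {p. prime p \<and> multiplicity p n \<ge> 2} \<le> t ^ 2 + 2"
proof -
  define A where "A = {p. prime p \<and> multiplicity p n \<ge> 2 \<and> t ^ 2 < p}"
  have n: "n > 0" using hc by (rule highly_composite_pos)
  have "p dvd n" if "multiplicity p n \<ge> 2" for p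
    using that not_dvd_imp_multiplicity_0[of p n] by force
  then have "A \<subseteq> {p. p dvd n}" by (auto simp: A_def)
  then have fin: "finite A" using n finite_subset finite_divisors_nat by blast
  have "card A \<le> 2"
  proof (rule card_le_two_if_no_three[OF fin])
    fix x y z assume xyz: "x \<in> A" "y \<in> A" "z \<in> A" "x \<noteq> y" "x \<noteq> z" "y \<noteq> z"
    then have "x * y * z \<le> q * q'"
      using hc q by (intro highly_composite_three_primes[of n]) (auto simp: A_def)
    also have "\<dots> \<le> t ^ 3 * t ^ 3" using t by (rule mult_le_mono)
    also have "\<dots> = t ^ 2 * t ^ 2 * t ^ 2" by (simp flip: power_add)
    also have "\<dots> < x * y * z"
      using xyz by (intro mult_strict_mono) (auto simp: A_def)
    finally show False by simp
  qed
  moreover have "{p. prime p \<and> multiplicity p n \<ge> 2} \<subseteq> A \<union> {1..t ^ 2}"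
    by (auto simp: A_def Suc_le_eq prime_gt_0_nat)
  then have "card {p. prime p \<and> multiplicity p n \<ge> 2} \<le> card (A \<union> {1..t ^ 2})"
    using fin by (intro card_mono) auto
  ultimately show ?thesis using card_Un_le[of A "{1..t ^ 2}"] by simp
qed

text \<open>Euclid's argument gives a prime in (L, L! + 1], which cannot divide \<open>m\<close>; it
  is traded against a power of 2.\<close>

lemma highly_composite_two_power_less:
  fixes m L E :: nat
  assumes hc: "highly_composite m" and dvd: "2 ^ E dvd m"
    and le: "\<And>r. prime r \<Longrightarrow> r dvd m \<Longrightarrow> r \<le> L"
  shows "E < 2 * (L ^ 2 + 2)"
proof -
  obtain Q where Q: "prime Q" "L < Q" "Q \<le> fact L + 1"
    using next_prime_bound[of L] by blast
  have nd: "\<not> Q dvd m" using le[OF Q(1)] Q(2) by auto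
  have "fact L \<le> L ^ L" using fact_le_power[of L, where 'a = nat] by simp
  also have "\<dots> \<le> (2 ^ L) ^ L" by (intro power_mono) (auto intro: less_imp_le)
  also have "\<dots> = 2 ^ (L ^ 2)" by (simp add: power2_eq_square flip: power_mult)
  finally have "fact L \<le> (2::nat) ^ (L ^ 2)" .
  moreover have "(1::nat) \<le> 2 ^ (L ^ 2)" by simp
  \<comment> \<open>L! + 1 is at most twice \<open>2 ^ (L ^ 2)\<close>; the second extra factor 2
    makes the bound strict.\<close>
  moreover have "(2::nat) ^ (L ^ 2 + 2) = 4 * 2 ^ (L ^ 2)" by simp
  ultimately have "Q < 2 ^ (L ^ 2 + 2)" using Q(3) by linarith
  then have "multiplicity 2 m < 2 * (L ^ 2 + 2)"
    using highly_composite_multiplicity_less[OF hc two_is_prime_nat Q(1) nd] by blast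
  moreover have "E \<le> multiplicity 2 m"
    using dvd highly_composite_pos[OF hc] by (intro multiplicity_geI) auto
  ultimately show ?thesis by simp
qed

lemma prime_count_unbounded: "\<exists>N. k \<le> prime_count N"
proof -
  obtain B where B: "B \<subseteq> {p::nat. prime p}" "finite B" "card B = k"
    using infinite_arbitrarily_large[OF primes_infinite, of k] by blast
  have "B \<subseteq> {p. prime p \<and> p \<le> Max B}" using B by auto
  then have "k \<le> prime_count (Max B)"
    unfolding prime_count_def B(3)[symmetric] by (intro card_mono finite_primes_le)
  then show ?thesis ..
qed

text \<open>Here \<open>t\<close> is least such that \<open>t\<^sup>3\<close> is at least the two smallest primes not dividing \<open>n\<close>, and
  \<open>3 L\<close> serves as the exponent \<open>j\<close> with \<open>q < 2\<^sup>j\<close>.\<close>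

lemma both_highly_composite_scale:
  fixes n :: nat
  assumes hc: "highly_composite n" and hcd: "highly_composite (divisor_count n)"
  obtains t L q where "t > 0" "prime q" "\<not> q dvd n" "q \<le> t ^ 3" "2 ^ L \<le> 2 * t"
    "prime_count ((t - 1) ^ 3) \<le> t ^ 2 + 72 * L ^ 2 + 7"
proof -
  have n: "n > 0" using hc by (rule highly_composite_pos)
  have "\<exists>q. prime q \<and> \<not> q dvd n"
  proof -
    obtain q where "prime q" "n < q" using bigger_prime by blast
    then show ?thesis using n dvd_imp_le[of q n] by (intro exI[of _ q]) auto
  qed
  define q where "q = (LEAST q. prime q \<and> \<not> q dvd n)"
  have q: "prime q" "\<not> q dvd n"
    using LeastI_ex[OF \<open>\<exists>q. prime q \<and> \<not> q dvd n\<close>] by (simp_all add: q_def)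
  have below: "p dvd n" if "prime p" "p < q" for p
    using not_less_Least[of p "\<lambda>q. prime q \<and> \<not> q dvd n"] that by (auto simp: q_def)
  define A where "A = {p. prime p \<and> p < q}"
  have finA: "finite A" unfolding A_def by (rule finite_subset[of _ "{..<q}"]) auto
  define t where "t = (LEAST t. card A + 2 \<le> prime_count (t ^ 3))"
  have "\<exists>t. card A + 2 \<le> prime_count (t ^ 3)"
  proof -
    obtain N where "card A + 2 \<le> prime_count N" using prime_count_unbounded by blast
    moreover have "N \<le> N ^ 3" by (cases "N = 0") (auto intro: self_le_power)
    ultimately show ?thesis using prime_count_mono[of N "N ^ 3"] by (meson le_trans)
  qed
  from LeastI_ex[OF this] have t: "card A + 2 \<le> prime_count (t ^ 3)" by (simp add: t_def)
  have t0: "t > 0" using t by (cases t) auto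
  have t1: "prime_count ((t - 1) ^ 3) \<le> card A + 1"
    using not_less_Least[of "t - 1" "\<lambda>t. card A + 2 \<le> prime_count (t ^ 3)"] t0
    unfolding t_def[symmetric] by simp
  \<comment> \<open>Primes up to \<open>t ^ 3\<close> that are at least \<open>q\<close>. There are
    two of them, so one differs from \<open>q\<close> and serves as \<open>q'\<close>.\<close>
  define P where "P = {p. prime p \<and> p \<le> t ^ 3} - A"
  have "card P \<ge> 2"
    using diff_card_le_card_Diff[OF finA, of "{p. prime p \<and> p \<le> t ^ 3}"] t
    by (simp add: P_def prime_count_def)
  then obtain B where "B \<subseteq> P" "card B = 2" using obtain_subset_with_card_n by metis
  then obtain x y where xy: "x \<in> P" "y \<in> P" "x \<noteq> y" unfolding card_2_iff by blast
  define q' where "q' = (if x = q then y else x)"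
  have ge: "prime z \<and> z \<le> t ^ 3 \<and> q \<le> z" if "z \<in> P" for z
    using that by (auto simp: P_def A_def)
  have q': "prime q'" "q' \<noteq> q" "q' \<le> t ^ 3" "q \<le> q'"
    using ge[OF xy(1)] ge[OF xy(2)] xy(3) by (auto simp: q'_def)
  have q'nd: "\<not> q' dvd n"
    using highly_composite_prime_dvd_less[OF hc q'(1) _ q] q' by auto
  have qt: "q \<le> t ^ 3" using q' by simp
  have card2: "card {p. prime p \<and> multiplicity p n \<ge> 2} \<le> t ^ 2 + 2"
    using q'(2) by (intro card_repeated_primes_le[OF hc q(1) q'(1) _ q(2) q'nd qt q'(3)]) simp
  define E where "E = {p. prime p \<and> multiplicity p n = 1}"
  have dvd: "p dvd n" if "multiplicity p n > 0" for p
    using that not_dvd_imp_multiplicity_0[of p n] by force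
  have finE: "finite E"
    by (rule finite_subset[OF _ finite_divisors_nat[OF n]]) (auto simp: E_def intro!: dvd)
  have fin2: "finite {p. prime p \<and> multiplicity p n \<ge> 2}"
    by (rule finite_subset[OF _ finite_divisors_nat[OF n]]) (auto intro!: dvd)
  have "A \<subseteq> E \<union> {p. prime p \<and> multiplicity p n \<ge> 2}"
  proof
    fix p assume "p \<in> A"
    then have "prime p" "p dvd n" using below by (auto simp: A_def)
    then have "multiplicity p n > 0" using n by (simp add: prime_multiplicity_gt_zero_iff)
    then show "p \<in> E \<union> {p. prime p \<and> multiplicity p n \<ge> 2}"
      using \<open>prime p\<close> by (auto simp: E_def)
  qed
  then have "card A \<le> card (E \<union> {p. prime p \<and> multiplicity p n \<ge> 2})"
    using finE fin2 by (intro card_mono) auto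
  then have A_le: "card A \<le> card E + t ^ 2 + 2"
    using card_Un_le[of E "{p. prime p \<and> multiplicity p n \<ge> 2}"] card2 by linarith
  \<comment> \<open>\<open>L0\<close> is the integer part of log2 t, so \<open>t < 2 ^ L\<close> and
    \<open>q <= t ^ 3 < 2 ^ (3 * L)\<close>.\<close>
  obtain L0 where L0: "2 ^ L0 \<le> t" "t < 2 ^ (L0 + 1)"
    using ex_power_ivl1[of 2 t] t0 by auto
  define L where "L = L0 + 1"
  have "t ^ 3 < (2 ^ L) ^ 3" using L0 by (intro power_strict_mono) (auto simp: L_def)
  then have q2: "q < 2 ^ (3 * L)" using qt by (simp add: power_mult[symmetric] mult.commute)
  have small: "multiplicity p n < 6 * L" if "prime p" for p
  proof -
    have "2 ^ (3 * L) \<le> p ^ (3 * L)" using that by (intro power_mono) (auto simp: prime_ge_2_nat)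
    with q2 have "q < p ^ (3 * L)" by linarith
    from highly_composite_multiplicity_less[OF hc that q this] show ?thesis by simp
  qed
  have "card E < 2 * ((6 * L) ^ 2 + 2)"
  proof (rule highly_composite_two_power_less[OF hcd])
    show "2 ^ card E dvd divisor_count n"
      by (rule two_power_dvd_divisor_count[OF finE n]) (simp add: E_def)
    show "r \<le> 6 * L" if "prime r" "r dvd divisor_count n" for r
      using prime_dvd_divisor_count_le[OF n small that] .
  qed
  then have "card E < 72 * L ^ 2 + 4" by (simp add: power_mult_distrib)
  \<comment> \<open>The 7 collects 4 from \<open>card E\<close>, 2 from the primes above
    \<open>t ^ 2\<close> and 1 from the minimality of \<open>t\<close>.\<close>
  then have "prime_count ((t - 1) ^ 3) \<le> t ^ 2 + 72 * L ^ 2 + 7" using A_le t1 by linarith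
  moreover have "2 ^ L \<le> 2 * t" using L0 by (simp add: L_def)
  ultimately show ?thesis using that t0 q qt by blast
qed

text \<open>By Chebyshev the prime count at \<open>(t - 1) ^ 3\<close> grows at least like t^3 / log
  t, whereas the assumed bound is t^2 + O((log t)^2).\<close>

lemma scale_bounded:
  obtains T where "\<And>t L. t > 0 \<Longrightarrow> 2 ^ L \<le> 2 * t \<Longrightarrow>
    prime_count ((t - 1) ^ 3) \<le> t ^ 2 + 72 * L ^ 2 + 7 \<Longrightarrow> t \<le> T"
proof -
  have "eventually (\<lambda>t::nat. (real t ^ 2 + 72 * (1 + log 2 (real t)) ^ 2 + 7) * ln ((real t - 1) ^ 3)
      < ((real t - 1) ^ 3 - 2) * ln 2) at_top"
    by real_asymp
  then obtain T where T: "\<And>t. t \<ge> T \<Longrightarrow>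
      (real t ^ 2 + 72 * (1 + log 2 (real t)) ^ 2 + 7) * ln ((real t - 1) ^ 3)
      < ((real t - 1) ^ 3 - 2) * ln 2"
    unfolding eventually_at_top_linorder by blast
  \<comment> \<open>The added 3 ensures \<open>(t - 1) ^ 3 >= 2\<close>, as the Chebyshev bound
    requires, and a nonnegative logarithm.\<close>
  have "t \<le> T + 3" if t: "t > 0" "2 ^ L \<le> 2 * t"
    "prime_count ((t - 1) ^ 3) \<le> t ^ 2 + 72 * L ^ 2 + 7" for t L
  proof (rule ccontr)
    assume "\<not> t \<le> T + 3"
    then have tT: "t \<ge> T" "t \<ge> 3" by auto
    have "real L \<le> 1 + log 2 (real t)"
    proof -
      have "real (2 ^ L) \<le> real (2 * t)" using t(2) by (simp only: of_nat_le_iff)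
      then have "2 ^ L \<le> 2 * real t" by simp
      then have "real L \<le> log 2 (2 * real t)" by (rule le_log_of_power) simp
      also have "\<dots> = 1 + log 2 (real t)" using t(1) by (simp add: log_mult)
      finally show ?thesis .
    qed
    then have L2: "real L ^ 2 \<le> (1 + log 2 (real t)) ^ 2" by (intro power_mono) auto
    have real_u: "real ((t - 1) ^ 3) = (real t - 1) ^ 3" using t(1) by (simp add: of_nat_diff)
    have "(2::nat) ^ 3 \<le> (t - 1) ^ 3" using tT by (intro power_mono) auto
    then have u: "(t - 1) ^ 3 \<ge> 2" by simp
    have "((real t - 1) ^ 3 - 2) * ln 2 \<le> real (prime_count ((t - 1) ^ 3)) * ln ((real t - 1) ^ 3)"
      using prime_count_ge[OF u] by (simp only: real_u)
    also have "\<dots> \<le> (real t ^ 2 + 72 * (1 + log 2 (real t)) ^ 2 + 7) * ln ((real t - 1) ^ 3)"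
    proof (rule mult_right_mono)
      have "real (prime_count ((t - 1) ^ 3)) \<le> real (t ^ 2 + 72 * L ^ 2 + 7)"
        using t(3) by (simp only: of_nat_le_iff)
      then show "real (prime_count ((t - 1) ^ 3)) \<le> real t ^ 2 + 72 * (1 + log 2 (real t)) ^ 2 + 7"
        using L2 by simp
      have "1 \<le> real t - 1" using tT by simp
      then show "0 \<le> ln ((real t - 1) ^ 3)" by (simp add: one_le_power)
    qed
    also have "\<dots> < ((real t - 1) ^ 3 - 2) * ln 2" by (rule T[OF tT(1)])
    finally show False by simp
  qed
  then show ?thesis by (rule that)
qed

theorem mainTheorem1:
  shows "finite {n :: nat. n > 0 \<and> highly_composite n \<and> highly_composite (divisor_count n)}"
proof -
  obtain T where T: "\<And>t L. t > 0 \<Longrightarrow> 2 ^ L \<le> 2 * t \<Longrightarrow>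
      prime_count ((t - 1) ^ 3) \<le> t ^ 2 + 72 * L ^ 2 + 7 \<Longrightarrow> t \<le> T"
    using scale_bounded by blast
  \<comment> \<open>Bounds, uniformly in \<open>n\<close>, a prime not dividing
    \<open>n\<close>.\<close>
  define Q where "Q = T ^ 3"
  have "n \<le> (Q ^ (2 * Q)) ^ Q"
    if hc: "highly_composite n" "highly_composite (divisor_count n)" for n
  proof -
    obtain t L q where tq: "t > 0" "prime q" "\<not> q dvd n" "q \<le> t ^ 3" "2 ^ L \<le> 2 * t"
      "prime_count ((t - 1) ^ 3) \<le> t ^ 2 + 72 * L ^ 2 + 7"
      using both_highly_composite_scale[OF hc] .
    have "t ^ 3 \<le> Q" unfolding Q_def using T[OF tq(1,5,6)] by (rule power_mono) simp
    with tq have "q \<le> Q" by simp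
    then show ?thesis using highly_composite_le[OF hc(1) tq(2,3)] by blast
  qed
  then have "{n. n > 0 \<and> highly_composite n \<and> highly_composite (divisor_count n)}
      \<subseteq> {..(Q ^ (2 * Q)) ^ Q}"
    by blast
  then show ?thesis by (rule finite_subset) (rule finite_atMost)
qed

end
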